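(* Let $\mathbf{I}_{2,0}$ be the variety of implication zroupoids satisfying $x''\approx x$. Then: (i) for every $\mathbf A\in\mathbf{I}_{2,0}$, the relation $\sqsubseteq$ on $A$ is a partial order; and (ii) if $\mathbf V$ is any subvariety of $\mathbf I$ such that $\sqsubseteq$ is a partial order on every algebra in $\mathbf V$, then $\mathbf V\subseteq\mathbf{I}_{2,0}$. That is, $\mathbf{I}_{2,0}$ is a maximal subvariety of $\mathbf I$ with respect to the property that $\sqsubseteq$ is a partial order on its members.
   Context: A zroupoid is an algebra $\mathbf A=\langle A,\to,0\rangle$ with a binary operation $\to$ and a constant $0$; write $x':=x\to 0$. An implication zroupoid (I-zroupoid) is a zroupoid satisfying the identities (I) $(x\to y)\to z\approx[(z'\to x)\to(y\to z)']'$ and $0''\approx 0$. $\mathbf I$ denotes the variety of I-zroupoids, and $\mathbf{I}_{2,0}$ the subvariety of $\mathbf I$ defined by $x''\approx x$. For $\mathbf A\in\mathbf I$ and $x,y\in A$, define $x\sqsubseteq y$ iff $(x\to y')'=x$. *)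

theory Defs
  imports Main
begin

record 'a zroupoid =
  carrier :: "'a set"
  imp :: "'a \<Rightarrow> 'a \<Rightarrow> 'a" (infixr "\<rightarrow>\<index>" 65)
  zero :: 'a ("\<zero>\<index>")

definition zroupoid :: "'a zroupoid \<Rightarrow> bool" where
  "zroupoid A \<longleftrightarrow>
     zero A \<in> carrier A \<and> (\<forall>x\<in>carrier A. \<forall>y\<in>carrier A. imp A x y \<in> carrier A)"

definition neg :: "'a zroupoid \<Rightarrow> 'a \<Rightarrow> 'a" where
  "neg A x = x \<rightarrow>\<^bsub>A\<^esub> \<zero>\<^bsub>A\<^esub>"

datatype trm = Var nat | Zero | Imp trm trm

abbreviation Neg :: "trm \<Rightarrow> trm" where
  "Neg t \<equiv> Imp t Zero"

type_synonym identity = "trm \<times> trm"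

primrec eval :: "'a zroupoid \<Rightarrow> (nat \<Rightarrow> 'a) \<Rightarrow> trm \<Rightarrow> 'a" where
  "eval A \<rho> (Var n) = \<rho> n"
| "eval A \<rho> Zero = \<zero>\<^bsub>A\<^esub>"
| "eval A \<rho> (Imp s t) = eval A \<rho> s \<rightarrow>\<^bsub>A\<^esub> eval A \<rho> t"

definition satisfies :: "'a zroupoid \<Rightarrow> identity \<Rightarrow> bool" where
  "satisfies A e \<longleftrightarrow>
     (\<forall>\<rho>. range \<rho> \<subseteq> carrier A \<longrightarrow> eval A \<rho> (fst e) = eval A \<rho> (snd e))"

definition models :: "identity set \<Rightarrow> 'a zroupoid set" where
  "models E = {A. zroupoid A \<and> (\<forall>e\<in>E. satisfies A e)}"

text \<open>
  Varieties are equational classes. HOL has no class of all algebras over all types, so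
  \<open>'a zroupoid set\<close> contains the part of a variety consisting of the algebras whose
  carrier is a subset of the type \<open>'a\<close>. As \<open>'a\<close> is arbitrary, a set of identities
  determines such a part at every type.
\<close>
definition variety :: "'a zroupoid set \<Rightarrow> bool" where
  "variety V \<longleftrightarrow> (\<exists>E. V = models E)"

definition subvariety :: "'a zroupoid set \<Rightarrow> 'a zroupoid set \<Rightarrow> bool" where
  "subvariety V W \<longleftrightarrow> variety V \<and> variety W \<and> V \<subseteq> W"

definition I_identities :: "identity set" where
  "I_identities =
     (let x = Var 0; y = Var 1; z = Var 2 in
       {(Imp (Imp x y) z, Neg (Imp (Imp (Neg z) x) (Neg (Imp y z)))),
        (Neg (Neg Zero), Zero)})"

definition I_zroupoids :: "'a zroupoid set" where
  "I_zroupoids = models I_identities"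

definition I_2_0 :: "'a zroupoid set" where
  "I_2_0 = {A \<in> I_zroupoids. satisfies A (Neg (Neg (Var 0)), Var 0)}"

definition sqle :: "'a zroupoid \<Rightarrow> 'a rel" where
  "sqle A = {(x, y). x \<in> carrier A \<and> y \<in> carrier A \<and> neg A (x \<rightarrow>\<^bsub>A\<^esub> neg A y) = x}"

definition maximal_subvariety ::
  "('a zroupoid \<Rightarrow> bool) \<Rightarrow> 'a zroupoid set \<Rightarrow> 'a zroupoid set \<Rightarrow> bool" where
  "maximal_subvariety P V W \<longleftrightarrow>
     subvariety V W \<and> (\<forall>A\<in>V. P A) \<and>
     (\<forall>U. subvariety U W \<and> (\<forall>A\<in>U. P A) \<and> V \<subseteq> U \<longrightarrow> U = V)"

end

theory Submission
  imports Defs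
begin

text \<open>
  If \<open>\<sqsubseteq>\<close> is reflexive then every element has the form \<open>u''\<close>, so the identity \<open>x'''' \<approx> x''\<close> of \<open>\<^bold>I\<close>
  forces \<open>x'' \<approx> x\<close>. Conversely, under \<open>x'' \<approx> x\<close>
  the relation \<open>x \<sqsubseteq> y\<close> reads \<open>x \<rightarrow> y' = x'\<close>, which implies \<open>y \<rightarrow> x' = x'\<close>; this gives antisymmetry.
  Transitivity is first proved after applying \<open>\<lambda>x. 0 \<rightarrow> x\<close>, which commutes with \<open>\<rightarrow>\<close>. This suffices
  for \<open>x \<rightarrow> z' = z \<rightarrow> x'\<close>, and the auxiliary element \<open>j = x' \<rightarrow> y\<close> then lets one evaluate \<open>z \<rightarrow> x'\<close>.
\<close>

section \<open>Consequences of (I) and \<open>0'' = 0\<close> alone\<close>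

locale implication_zroupoid =
  fixes A :: "'a zroupoid" (structure)
  assumes zero_closed [simp, intro]: "\<zero> \<in> carrier A"
    and imp_closed [simp, intro]: "\<lbrakk>x \<in> carrier A; y \<in> carrier A\<rbrakk> \<Longrightarrow> x \<rightarrow> y \<in> carrier A"
    and imp_imp: "\<lbrakk>x \<in> carrier A; y \<in> carrier A; z \<in> carrier A\<rbrakk> \<Longrightarrow>
      (x \<rightarrow> y) \<rightarrow> z = (((z \<rightarrow> \<zero>) \<rightarrow> x) \<rightarrow> ((y \<rightarrow> z) \<rightarrow> \<zero>)) \<rightarrow> \<zero>"
    and zero_zero_zero: "(\<zero> \<rightarrow> \<zero>) \<rightarrow> \<zero> = \<zero>"
begin

abbreviation compl ("\<sim> _" [80] 80) where "\<sim> x \<equiv> x \<rightarrow> \<zero>"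

lemma compl_imp:
  assumes "x \<in> carrier A" "y \<in> carrier A"
  shows "\<sim> (x \<rightarrow> y) = \<sim> ((\<sim> \<zero> \<rightarrow> x) \<rightarrow> \<sim> \<sim> y)"
  using assms by (simp add: imp_imp [of x y \<zero>])

lemma zero_imp_imp:
  assumes "x \<in> carrier A" "y \<in> carrier A"
  shows "(\<zero> \<rightarrow> x) \<rightarrow> y = \<sim> (\<sim> \<sim> y \<rightarrow> \<sim> (x \<rightarrow> y))"
  using assms by (simp add: imp_imp [of \<zero> x y])

lemma compl_compl_one_imp:
  assumes "x \<in> carrier A"
  shows "\<sim> \<sim> (\<sim> \<zero> \<rightarrow> x) = \<sim> \<sim> x"
  using assms compl_imp [of x \<zero>] by (simp add: zero_zero_zero)

text \<open>By \<open>compl_imp\<close>, the complement of \<open>x \<rightarrow> y\<close> depends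
  on \<open>y\<close> only through \<open>\<sim> \<sim> y\<close>.\<close>

lemma compl_imp_one_imp:
  assumes "x \<in> carrier A" "y \<in> carrier A"
  shows "\<sim> (x \<rightarrow> (\<sim> \<zero> \<rightarrow> y)) = \<sim> (x \<rightarrow> y)"
  using assms compl_imp [of x y] compl_imp [of x "\<sim> \<zero> \<rightarrow> y"] by (simp add: compl_compl_one_imp)

lemma one_imp_idem:
  assumes "x \<in> carrier A"
  shows "\<sim> \<zero> \<rightarrow> (\<sim> \<zero> \<rightarrow> x) = \<sim> \<zero> \<rightarrow> x"
proof -
  \<comment> \<open>The outer \<open>\<sim> \<zero>\<close> is
    \<open>\<zero> \<rightarrow> \<zero>\<close>, so \<open>zero_imp_imp\<close> applies with
    \<open>\<zero>\<close> as its first argument.\<close>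
  have "\<sim> \<zero> \<rightarrow> (\<sim> \<zero> \<rightarrow> x) = \<sim> (\<sim> \<sim> (\<sim> \<zero> \<rightarrow> x) \<rightarrow> \<sim> (\<zero> \<rightarrow> (\<sim> \<zero> \<rightarrow> x)))"
    using assms by (intro zero_imp_imp) auto
  also have "\<dots> = \<sim> (\<sim> \<sim> x \<rightarrow> \<sim> (\<zero> \<rightarrow> x))"
    using assms by (simp only: compl_compl_one_imp compl_imp_one_imp zero_closed)
  also have "\<dots> = \<sim> \<zero> \<rightarrow> x"
    using assms by (intro zero_imp_imp [symmetric]) auto
  finally show ?thesis .
qed

lemma compl_imp_compl_compl:
  assumes "x \<in> carrier A" "y \<in> carrier A"
  shows "\<sim> (x \<rightarrow> \<sim> \<sim> y) = \<sim> (x \<rightarrow> y)"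
proof -
  \<comment> \<open>Both sides have the same expansion under \<open>compl_imp\<close>, since
    \<open>one_imp_idem\<close> absorbs the repeated \<open>\<sim> \<zero>\<close>.\<close>
  have *: "\<sim> (x \<rightarrow> y) = \<sim> ((\<sim> \<zero> \<rightarrow> x) \<rightarrow> y)" if "y \<in> carrier A" for y
    using assms that compl_imp [of x y] compl_imp [of "\<sim> \<zero> \<rightarrow> x" y] by (simp add: one_imp_idem)
  show ?thesis
    using assms * [of "\<sim> \<sim> y"] compl_imp [of x y] by simp
qed

text \<open>Prefixing \<open>\<sim> \<zero>\<close> puts the inner double complement to the right of
  an implication, where \<open>compl_imp_compl_compl\<close> deletes it.\<close>

lemma compl_compl_compl_compl:
  assumes "x \<in> carrier A"
  shows "\<sim> \<sim> \<sim> \<sim> x = \<sim> \<sim> x"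
proof -
  have "\<sim> \<sim> \<sim> \<sim> x = \<sim> \<sim> (\<sim> \<zero> \<rightarrow> \<sim> \<sim> x)"
    using assms by (simp add: compl_compl_one_imp)
  also have "\<dots> = \<sim> \<sim> (\<sim> \<zero> \<rightarrow> x)"
    using assms by (simp only: compl_imp_compl_compl imp_closed zero_closed)
  also have "\<dots> = \<sim> \<sim> x"
    using assms by (rule compl_compl_one_imp)
  finally show ?thesis .
qed

end

section \<open>Implication calculus under \<open>x'' = x\<close>\<close>

locale involutive_implication_zroupoid = implication_zroupoid +
  assumes compl_compl [simp]: "x \<in> carrier A \<Longrightarrow> \<sim> \<sim> x = x"
begin

lemma one_imp [simp]: "x \<in> carrier A \<Longrightarrow> \<sim> \<zero> \<rightarrow> x = x"
  using compl_compl_one_imp [of x] by simp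

lemma zero_imp_imp': "\<lbrakk>x \<in> carrier A; y \<in> carrier A\<rbrakk> \<Longrightarrow> (\<zero> \<rightarrow> x) \<rightarrow> y = \<sim> (y \<rightarrow> \<sim> (x \<rightarrow> y))"
  using zero_imp_imp [of x y] by simp

lemma zero_imp_imp_one:
  assumes "x \<in> carrier A" shows "(\<zero> \<rightarrow> x) \<rightarrow> \<sim> \<zero> = x \<rightarrow> \<sim> \<zero>"
  using assms zero_imp_imp' [of x "\<sim> \<zero>"] by simp

lemma zero_imp_one [simp]: "\<zero> \<rightarrow> \<sim> \<zero> = \<sim> \<zero>"
  using zero_imp_imp_one [of \<zero>] by simp

text \<open>This is reflexivity of the order. By \<open>zero_imp_one\<close>, the left side of
  \<open>zero_imp_imp'\<close> at \<open>\<sim> \<zero>\<close> collapses to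
  \<open>x\<close>.\<close>

lemma imp_compl_self [simp]:
  assumes "x \<in> carrier A" shows "x \<rightarrow> \<sim> x = \<sim> x"
proof -
  have "x = \<sim> (x \<rightarrow> \<sim> x)"
    using assms zero_imp_imp' [of "\<sim> \<zero>" x] by simp
  then show ?thesis
    using assms by (metis compl_compl imp_closed zero_closed)
qed

lemma compl_imp_self [simp]: "x \<in> carrier A \<Longrightarrow> \<sim> x \<rightarrow> x = x"
  using imp_compl_self [of "\<sim> x"] by simp

text \<open>As \<open>\<sim> y \<rightarrow> y\<close> is \<open>y\<close>, (I) expands the left
  side just as \<open>zero_imp_imp'\<close> expands the right.\<close>

lemma imp_imp_self:
  assumes "x \<in> carrier A" "y \<in> carrier A" shows "(y \<rightarrow> x) \<rightarrow> y = (\<zero> \<rightarrow> x) \<rightarrow> y"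
  using assms imp_imp [of y x y] zero_imp_imp' [of x y] by simp

lemma compl_imp_one:
  assumes "x \<in> carrier A" shows "\<sim> x \<rightarrow> \<sim> \<zero> = \<zero> \<rightarrow> x"
proof -
  have "\<sim> x \<rightarrow> \<sim> \<zero> = \<sim> ((\<zero> \<rightarrow> x) \<rightarrow> \<zero>)"
    using assms imp_imp [of x \<zero> "\<sim> \<zero>"] by simp
  then show ?thesis using assms by simp
qed

lemma imp_one: "x \<in> carrier A \<Longrightarrow> x \<rightarrow> \<sim> \<zero> = \<zero> \<rightarrow> \<sim> x"
  using compl_imp_one [of "\<sim> x"] by simp

lemma zero_compl_zero:
  assumes "x \<in> carrier A" shows "\<zero> \<rightarrow> \<sim> (\<zero> \<rightarrow> x) = \<zero> \<rightarrow> \<sim> x"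
  using assms zero_imp_imp_one [of x] imp_one by simp

text \<open>Write \<open>f\<close> for prefixing \<open>\<zero>\<close> and \<open>n\<close> for
  complement. Then \<open>zero_compl_zero\<close> says \<open>fnf = fn\<close>, whence
  \<open>ff = fnfnf = fnfn = fnn = f\<close>.\<close>

lemma zero_zero_imp:
  assumes "x \<in> carrier A" shows "\<zero> \<rightarrow> (\<zero> \<rightarrow> x) = \<zero> \<rightarrow> x"
  using assms zero_compl_zero [of x] zero_compl_zero [of "\<sim> x"] zero_compl_zero [of "\<zero> \<rightarrow> \<sim> x"]
    zero_compl_zero [of "\<sim> (\<zero> \<rightarrow> x)"] zero_compl_zero [of "\<zero> \<rightarrow> x"] by simp

text \<open>Both left sides expand by (I) to
  \<open>\<sim> ((y \<rightarrow> x) \<rightarrow> y)\<close>, because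
  \<open>\<sim> \<zero> \<rightarrow> \<sim> y\<close> and \<open>y \<rightarrow> \<sim> y\<close>
  are both \<open>\<sim> y\<close>.\<close>

lemma imp_one_imp_compl:
  assumes "x \<in> carrier A" "y \<in> carrier A"
  shows "(x \<rightarrow> \<sim> \<zero>) \<rightarrow> \<sim> y = \<sim> ((\<zero> \<rightarrow> x) \<rightarrow> y)" "(x \<rightarrow> y) \<rightarrow> \<sim> y = \<sim> ((\<zero> \<rightarrow> x) \<rightarrow> y)"
  using assms imp_imp [of x "\<sim> \<zero>" "\<sim> y"] imp_imp [of x y "\<sim> y"] imp_imp_self by simp_all

lemma imp_compl_imp:
  assumes "x \<in> carrier A" "y \<in> carrier A"
  shows "(x \<rightarrow> \<sim> y) \<rightarrow> y = (x \<rightarrow> \<sim> \<zero>) \<rightarrow> y"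
  using assms imp_one_imp_compl [of x "\<sim> y"] by simp

lemma zero_imp_compl_imp_zero_imp:
  assumes "x \<in> carrier A" "y \<in> carrier A"
  shows "\<zero> \<rightarrow> \<sim> (x \<rightarrow> \<sim> y) = \<sim> x \<rightarrow> (\<zero> \<rightarrow> y)"
proof -
  have "\<zero> \<rightarrow> \<sim> (x \<rightarrow> \<sim> y) = (x \<rightarrow> \<sim> y) \<rightarrow> \<sim> \<zero>"
    using assms by (simp add: imp_one)
  also have "\<dots> = \<sim> ((\<zero> \<rightarrow> x) \<rightarrow> \<sim> (\<zero> \<rightarrow> y))"
    using assms imp_imp [of x "\<sim> y" "\<sim> \<zero>"] by (simp add: imp_one)
  \<comment> \<open>The term is padded into the shape of (I) with middle argument
    \<open>\<zero>\<close> and last argument \<open>\<zero> \<rightarrow> y\<close>, to be read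
    backwards next.\<close>
  also have "\<dots> = \<sim> ((\<sim> (\<zero> \<rightarrow> y) \<rightarrow> x) \<rightarrow> \<sim> (\<zero> \<rightarrow> (\<zero> \<rightarrow> y)))"
    using assms imp_imp_self [of x "\<sim> (\<zero> \<rightarrow> y)"] by (simp add: zero_zero_imp)
  also have "\<dots> = \<sim> x \<rightarrow> (\<zero> \<rightarrow> y)"
    using assms imp_imp [of x \<zero> "\<zero> \<rightarrow> y"] by simp
  finally show ?thesis .
qed

lemma zero_imp_compl_compl_imp:
  assumes "x \<in> carrier A" "y \<in> carrier A"
  shows "\<zero> \<rightarrow> \<sim> (\<sim> x \<rightarrow> y) = \<zero> \<rightarrow> (x \<rightarrow> \<sim> y)"
proof -
  \<comment> \<open>In the expansion by (I) at \<open>\<sim> \<zero>\<close>,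
    \<open>zero_compl_zero\<close> lets \<open>\<zero> \<rightarrow> v\<close> count as
    \<open>v\<close>.\<close>
  have "\<zero> \<rightarrow> \<sim> (u \<rightarrow> v) = (u \<rightarrow> (\<zero> \<rightarrow> v)) \<rightarrow> \<sim> \<zero>" if "u \<in> carrier A" "v \<in> carrier A" for u v
    using that imp_imp [of u "\<zero> \<rightarrow> v" "\<sim> \<zero>"] imp_imp [of u v "\<sim> \<zero>"]
    by (simp add: imp_one zero_compl_zero)
  from this [of "\<sim> x" y] have "\<zero> \<rightarrow> \<sim> (\<sim> x \<rightarrow> y) = (\<sim> x \<rightarrow> (\<zero> \<rightarrow> y)) \<rightarrow> \<sim> \<zero>"
    using assms by simp
  also have "\<dots> = (\<zero> \<rightarrow> \<sim> (x \<rightarrow> \<sim> y)) \<rightarrow> \<sim> \<zero>"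
    using assms by (simp only: zero_imp_compl_imp_zero_imp)
  also have "\<dots> = \<zero> \<rightarrow> (x \<rightarrow> \<sim> y)"
    using assms by (simp add: zero_imp_imp_one compl_imp_one)
  finally show ?thesis .
qed

lemma imp_zero_imp:
  assumes "x \<in> carrier A" "y \<in> carrier A"
  shows "x \<rightarrow> (\<zero> \<rightarrow> y) = \<zero> \<rightarrow> (x \<rightarrow> y)"
  using assms zero_imp_compl_imp_zero_imp [of "\<sim> x" y] zero_imp_compl_compl_imp [of x "\<sim> y"]
  by simp

text \<open>Hence \<open>\<lambda>x. \<zero> \<rightarrow> x\<close> is an idempotent endomorphism with respect to \<open>\<rightarrow>\<close>.\<close>

lemma zero_imp_imp_zero_imp:
  assumes "x \<in> carrier A" "y \<in> carrier A"
  shows "(\<zero> \<rightarrow> x) \<rightarrow> (\<zero> \<rightarrow> y) = \<zero> \<rightarrow> (x \<rightarrow> y)"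
proof -
  have "(\<zero> \<rightarrow> x) \<rightarrow> (\<zero> \<rightarrow> y) = \<sim> ((\<zero> \<rightarrow> y) \<rightarrow> \<sim> (x \<rightarrow> (\<zero> \<rightarrow> y)))"
    using assms by (simp add: zero_imp_imp')
  also have "\<dots> = (\<sim> \<zero> \<rightarrow> x) \<rightarrow> (\<zero> \<rightarrow> y)"
    using assms imp_imp [of "\<sim> \<zero>" x "\<zero> \<rightarrow> y"] compl_imp_one [of "\<zero> \<rightarrow> y"]
    by (simp add: zero_zero_imp)
  finally show ?thesis
    using assms by (simp add: imp_zero_imp)
qed

lemma compl_imp_zero_imp:
  assumes "x \<in> carrier A" "y \<in> carrier A"
  shows "\<sim> (x \<rightarrow> y) \<rightarrow> (\<zero> \<rightarrow> y) = \<zero> \<rightarrow> (x \<rightarrow> y)"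
proof -
  have "\<sim> (x \<rightarrow> y) \<rightarrow> (\<zero> \<rightarrow> y) = \<zero> \<rightarrow> \<sim> ((x \<rightarrow> y) \<rightarrow> \<sim> y)"
    using assms by (simp add: zero_imp_compl_imp_zero_imp)
  also have "\<dots> = \<zero> \<rightarrow> ((\<zero> \<rightarrow> x) \<rightarrow> y)"
    using assms by (simp add: imp_one_imp_compl)
  also have "\<dots> = \<zero> \<rightarrow> (x \<rightarrow> y)"
    using assms by (metis imp_closed zero_closed zero_imp_imp_zero_imp zero_zero_imp)
  finally show ?thesis .
qed

text \<open>(I) joins \<open>\<zero> \<rightarrow> w\<close> to
  \<open>\<sim> (v \<rightarrow> w)\<close>, and the result depends on
  \<open>v \<rightarrow> w\<close> only. With \<open>\<sim> \<zero>\<close> in place of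
  \<open>\<zero> \<rightarrow> w\<close> it is the same.\<close>

lemma zero_imp_imp_imp_absorb:
  assumes "u \<in> carrier A" "v \<in> carrier A" "w \<in> carrier A"
  shows "((\<zero> \<rightarrow> w) \<rightarrow> u) \<rightarrow> (v \<rightarrow> w) = u \<rightarrow> (v \<rightarrow> w)"
proof -
  have "((\<zero> \<rightarrow> w) \<rightarrow> u) \<rightarrow> (v \<rightarrow> w) = \<sim> ((\<zero> \<rightarrow> (v \<rightarrow> w)) \<rightarrow> \<sim> (u \<rightarrow> (v \<rightarrow> w)))"
    using assms imp_imp [of "\<zero> \<rightarrow> w" u "v \<rightarrow> w"] by (simp add: compl_imp_zero_imp)
  also have "\<dots> = (\<sim> \<zero> \<rightarrow> u) \<rightarrow> (v \<rightarrow> w)"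
    using assms imp_imp [of "\<sim> \<zero>" u "v \<rightarrow> w"] by (simp add: compl_imp_one)
  finally show ?thesis using assms by simp
qed

lemma zero_imp_imp_imp:
  assumes "u \<in> carrier A" "v \<in> carrier A" "w \<in> carrier A"
  shows "((\<zero> \<rightarrow> u) \<rightarrow> v) \<rightarrow> w = (\<zero> \<rightarrow> \<sim> u) \<rightarrow> (v \<rightarrow> w)"
proof -
  have "((\<zero> \<rightarrow> u) \<rightarrow> v) \<rightarrow> w = \<sim> ((\<zero> \<rightarrow> (\<sim> w \<rightarrow> u)) \<rightarrow> \<sim> (v \<rightarrow> w))"
    using assms imp_imp [of "\<zero> \<rightarrow> u" v w] by (simp add: imp_zero_imp)
  also have "\<zero> \<rightarrow> (\<sim> w \<rightarrow> u) = (w \<rightarrow> \<sim> u) \<rightarrow> \<sim> \<zero>"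
    using assms zero_imp_compl_compl_imp [of "\<sim> w" "\<sim> u"] by (simp add: imp_one)
  also have "\<sim> (\<dots> \<rightarrow> \<sim> (v \<rightarrow> w)) = (\<zero> \<rightarrow> (w \<rightarrow> \<sim> u)) \<rightarrow> (v \<rightarrow> w)"
    using assms by (simp add: imp_one_imp_compl)
  \<comment> \<open>The endomorphism property isolates \<open>\<zero> \<rightarrow> w\<close>, which
    can then be absorbed.\<close>
  also have "\<dots> = ((\<zero> \<rightarrow> w) \<rightarrow> (\<zero> \<rightarrow> \<sim> u)) \<rightarrow> (v \<rightarrow> w)"
    using assms by (simp add: zero_imp_imp_zero_imp)
  also have "\<dots> = (\<zero> \<rightarrow> \<sim> u) \<rightarrow> (v \<rightarrow> w)"
    using assms by (simp add: zero_imp_imp_imp_absorb)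
  finally show ?thesis .
qed

lemma imp_left_idem:
  assumes "x \<in> carrier A" "y \<in> carrier A"
  shows "x \<rightarrow> (x \<rightarrow> y) = x \<rightarrow> y"
proof -
  have "x \<rightarrow> (x \<rightarrow> y) = ((\<zero> \<rightarrow> y) \<rightarrow> x) \<rightarrow> (x \<rightarrow> y)"
    using assms by (simp add: zero_imp_imp_imp_absorb)
  \<comment> \<open>\<open>imp_imp_self\<close> is used twice: first to reach
    \<open>(x \<rightarrow> y) \<rightarrow> x\<close>, then with \<open>x \<rightarrow> y\<close>
    as the repeated element.\<close>
  also have "\<dots> = (\<zero> \<rightarrow> x) \<rightarrow> (x \<rightarrow> y)"
    using assms by (metis imp_closed imp_imp_self zero_closed)
  also have "\<dots> = ((\<zero> \<rightarrow> \<sim> x) \<rightarrow> x) \<rightarrow> y"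
    using assms zero_imp_imp_imp [of "\<sim> x" x y] by simp
  also have "\<dots> = x \<rightarrow> y"
    using assms imp_imp_self [of "\<sim> x" x] by simp
  finally show ?thesis .
qed

lemma zero_imp_imp_absorb:
  assumes "x \<in> carrier A" "y \<in> carrier A"
  shows "((\<zero> \<rightarrow> y) \<rightarrow> x) \<rightarrow> y = x \<rightarrow> y"
proof -
  have "((\<zero> \<rightarrow> y) \<rightarrow> x) \<rightarrow> y = ((x \<rightarrow> y) \<rightarrow> x) \<rightarrow> y"
    using assms by (simp add: imp_imp_self)
  also have "\<dots> = \<sim> ((\<sim> y \<rightarrow> (x \<rightarrow> y)) \<rightarrow> \<sim> (x \<rightarrow> y))"
    using assms imp_imp [of "x \<rightarrow> y" x y] by simp
  also have "\<dots> = \<sim> ((\<sim> y \<rightarrow> \<sim> \<zero>) \<rightarrow> \<sim> (x \<rightarrow> y))"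
    using assms imp_compl_imp [of "\<sim> y" "\<sim> (x \<rightarrow> y)"] by simp
  also have "\<dots> = (\<sim> \<zero> \<rightarrow> x) \<rightarrow> y"
    using assms imp_imp [of "\<sim> \<zero>" x y] by simp
  finally show ?thesis using assms by simp
qed

section \<open>Commutation, antisymmetry and transitivity for the order\<close>

lemma zero_imp_compl_cong:
  assumes "a \<in> carrier A" "b \<in> carrier A" "\<zero> \<rightarrow> a = \<zero> \<rightarrow> b"
  shows "\<zero> \<rightarrow> \<sim> a = \<zero> \<rightarrow> \<sim> b"
  using assms zero_compl_zero by metis

lemma zero_imp_flip:
  assumes "x \<in> carrier A" "y \<in> carrier A" "\<zero> \<rightarrow> (x \<rightarrow> \<sim> y) = \<zero> \<rightarrow> \<sim> x"
  shows "\<zero> \<rightarrow> (\<sim> x \<rightarrow> y) = \<zero> \<rightarrow> x"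
  using assms zero_imp_compl_cong [of "x \<rightarrow> \<sim> y" "\<sim> x"] zero_imp_compl_compl_imp [of "\<sim> x" "\<sim> y"]
  by simp

text \<open>Every \<open>w\<close> equals
  \<open>\<sim> (w \<rightarrow> \<sim> (\<zero> \<rightarrow> w))\<close>. For
  \<open>w = x \<rightarrow> \<sim> y\<close> the hypothesis turns this into the expansion of
  \<open>\<sim> \<sim> y \<rightarrow> \<sim> x\<close> by (I).\<close>

lemma imp_compl_commute:
  assumes "x \<in> carrier A" "y \<in> carrier A" "\<zero> \<rightarrow> (x \<rightarrow> \<sim> y) = \<zero> \<rightarrow> \<sim> x"
  shows "x \<rightarrow> \<sim> y = y \<rightarrow> \<sim> x"
proof -
  have "x \<rightarrow> \<sim> y = \<sim> ((x \<rightarrow> \<sim> y) \<rightarrow> \<sim> (\<zero> \<rightarrow> (x \<rightarrow> \<sim> y)))"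
    using assms(1,2) zero_imp_imp' [of \<zero> "x \<rightarrow> \<sim> y"] by simp
  also have "\<dots> = y \<rightarrow> \<sim> x"
    using assms imp_imp [of "\<sim> y" \<zero> "\<sim> x"] by simp
  finally show ?thesis .
qed

lemma sqle_imp_imp:
  assumes "x \<in> carrier A" "y \<in> carrier A" "u \<in> carrier A" "x \<rightarrow> \<sim> y = \<sim> x"
  shows "(u \<rightarrow> x) \<rightarrow> \<sim> y = \<sim> ((y \<rightarrow> u) \<rightarrow> x)"
  using assms imp_imp [of u x "\<sim> y"] by simp

lemma sqle_imp_compl:
  assumes "x \<in> carrier A" "y \<in> carrier A" "x \<rightarrow> \<sim> y = \<sim> x"
  shows "y \<rightarrow> \<sim> x = \<sim> x"
  using assms imp_imp [of "\<sim> y" \<zero> "\<sim> x"] zero_imp_imp' [of \<zero> "\<sim> x"] by simp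

lemma sqle_antisym:
  assumes "x \<in> carrier A" "y \<in> carrier A" "x \<rightarrow> \<sim> y = \<sim> x" "y \<rightarrow> \<sim> x = \<sim> y"
  shows "x = y"
  using assms sqle_imp_compl compl_compl by metis

lemma sqle_trans:
  assumes x [simp]: "x \<in> carrier A" and y [simp]: "y \<in> carrier A" and z [simp]: "z \<in> carrier A"
    and xy: "x \<rightarrow> \<sim> y = \<sim> x" and yz: "y \<rightarrow> \<sim> z = \<sim> y"
  shows "x \<rightarrow> \<sim> z = \<sim> x"
proof -
  \<comment> \<open>\<open>j\<close> stands in for \<open>x\<close>: it lies below \<open>z\<close>
    by fact \<open>6\<close> and has the same image as \<open>x\<close> under prefixing
    \<open>\<zero>\<close> by fact \<open>7\<close>.\<close>
  define j where "j = \<sim> x \<rightarrow> y"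
  have j [simp]: "j \<in> carrier A"
    by (simp add: j_def)
  have 1: "(\<zero> \<rightarrow> \<sim> x) \<rightarrow> y = j"
    using imp_compl_imp [of x y] xy by (simp add: imp_one j_def)
  have 2: "\<sim> (\<sim> y \<rightarrow> x) \<rightarrow> y = j"
  proof -
    have "\<sim> (\<sim> y \<rightarrow> x) \<rightarrow> y = ((\<zero> \<rightarrow> x) \<rightarrow> \<sim> y) \<rightarrow> y"
      using sqle_imp_imp [OF x y zero_closed xy] by simp
    also have "\<dots> = j"
      using 1 by (simp add: imp_compl_imp imp_one zero_compl_zero)
    finally show ?thesis .
  qed
  have 3: "(\<sim> z \<rightarrow> x) \<rightarrow> \<sim> y = \<sim> (\<sim> y \<rightarrow> x)"
    using sqle_imp_imp [OF x y _ xy, of "\<sim> z"] yz by simp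
  have 4: "(\<zero> \<rightarrow> (z \<rightarrow> \<sim> x)) \<rightarrow> y = j"
    using imp_compl_imp [of "\<sim> z \<rightarrow> x" y] 2 3 by (simp add: imp_one zero_imp_compl_compl_imp)
  have 5: "(z \<rightarrow> u) \<rightarrow> y = \<sim> ((u \<rightarrow> y) \<rightarrow> \<sim> z)" if "u \<in> carrier A" for u
    using sqle_imp_imp [OF y z that yz] that by simp
  have "j = \<sim> (j \<rightarrow> \<sim> z)"
  proof -
    \<comment> \<open>This \<open>u\<close> satisfies \<open>z \<rightarrow> u = u\<close> and, by
      fact \<open>4\<close>, \<open>u \<rightarrow> y = j\<close>, so fact \<open>5\<close> returns
      \<open>j\<close>.\<close>
    have "\<sim> (j \<rightarrow> \<sim> z) = (z \<rightarrow> (\<zero> \<rightarrow> (z \<rightarrow> \<sim> x))) \<rightarrow> y"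
      using 5 [of "\<zero> \<rightarrow> (z \<rightarrow> \<sim> x)"] 4 by simp
    also have "\<dots> = j"
      using 4 by (simp add: imp_zero_imp imp_left_idem)
    finally show ?thesis by simp
  qed
  then have 6: "j \<rightarrow> \<sim> z = \<sim> j"
    using compl_compl [of "j \<rightarrow> \<sim> z"] by simp
  have 7: "\<zero> \<rightarrow> j = \<zero> \<rightarrow> x"
    using zero_imp_flip [of x y] xy by (simp add: j_def)
  have 8: "\<zero> \<rightarrow> \<sim> j = \<zero> \<rightarrow> \<sim> x"
    using zero_imp_compl_cong [OF _ _ 7] by simp
  have "\<zero> \<rightarrow> (x \<rightarrow> \<sim> z) = (\<zero> \<rightarrow> j) \<rightarrow> (\<zero> \<rightarrow> \<sim> z)"
    by (simp add: 7 zero_imp_imp_zero_imp)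
  also have "\<dots> = \<zero> \<rightarrow> \<sim> x"
    by (simp add: 6 8 zero_imp_imp_zero_imp)
  finally have 9: "\<zero> \<rightarrow> (x \<rightarrow> \<sim> z) = \<zero> \<rightarrow> \<sim> x" .
  note 10 = zero_imp_flip [OF x z 9]
  have 11: "\<sim> x \<rightarrow> z = \<sim> z \<rightarrow> x"
    using imp_compl_commute [of "\<sim> x" "\<sim> z"] 10 by simp
  have 12: "\<sim> y \<rightarrow> x = j"
    using imp_compl_commute [of "\<sim> x" "\<sim> y"] 7 by (simp add: j_def)
  have "\<sim> j \<rightarrow> z = ((\<sim> z \<rightarrow> x) \<rightarrow> \<sim> y) \<rightarrow> z"
    using 3 12 by simp
  \<comment> \<open>(I) prefixes a second \<open>\<sim> z\<close> to
    \<open>\<sim> z \<rightarrow> x\<close>, and left idempotence removes it.\<close>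
  also have "\<dots> = (x \<rightarrow> \<sim> y) \<rightarrow> z"
    using imp_imp [of "\<sim> z \<rightarrow> x" "\<sim> y" z] imp_imp [of x "\<sim> y" z] by (simp add: imp_left_idem)
  finally have 13: "\<sim> j \<rightarrow> z = \<sim> x \<rightarrow> z"
    by (simp add: xy)
  have 14: "\<sim> j \<rightarrow> z = (\<zero> \<rightarrow> \<sim> x) \<rightarrow> z"
    using imp_compl_imp [of j z] 6 8 by (simp add: imp_one)
  have "x \<rightarrow> \<sim> z = z \<rightarrow> \<sim> x"
    using 9 by (intro imp_compl_commute) simp_all
  \<comment> \<open>Facts \<open>13\<close> and \<open>14\<close> identify
    \<open>(\<zero> \<rightarrow> \<sim> x) \<rightarrow> z\<close>, the term produced by
    absorption, with \<open>\<sim> x \<rightarrow> z\<close>.\<close>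
  also have "\<dots> = (\<sim> x \<rightarrow> z) \<rightarrow> \<sim> x"
    using zero_imp_imp_absorb [of z "\<sim> x"] 13 14 by simp
  also have "\<dots> = (\<zero> \<rightarrow> (\<sim> x \<rightarrow> z)) \<rightarrow> \<sim> x"
    using imp_imp_self [of "\<sim> x \<rightarrow> z" "\<sim> x"] by (simp add: imp_left_idem)
  also have "\<dots> = \<sim> x"
    using imp_imp_self [of x "\<sim> x"] by (simp add: 10)
  finally show ?thesis .
qed

end

section \<open>From equational classes to the locales, and the maximality statement\<close>

lemma I_zroupoids_iff: "A \<in> I_zroupoids \<longleftrightarrow> implication_zroupoid A"
proof
  assume A: "A \<in> I_zroupoids"
  then have cl: "zroupoid A"
    by (simp add: I_zroupoids_def models_def)
  have e: "eval A \<rho> (fst i) = eval A \<rho> (snd i)"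
    if "i \<in> I_identities" "range \<rho> \<subseteq> carrier A" for i \<rho>
    using A that by (auto simp: I_zroupoids_def models_def satisfies_def)
  show "implication_zroupoid A"
  proof
    show "\<zero>\<^bsub>A\<^esub> \<in> carrier A"
      using cl by (simp add: zroupoid_def)
    then show "(\<zero>\<^bsub>A\<^esub> \<rightarrow>\<^bsub>A\<^esub> \<zero>\<^bsub>A\<^esub>) \<rightarrow>\<^bsub>A\<^esub> \<zero>\<^bsub>A\<^esub> = \<zero>\<^bsub>A\<^esub>"
      using e [of "(Neg (Neg Zero), Zero)" "\<lambda>_. \<zero>\<^bsub>A\<^esub>"] by (auto simp: I_identities_def Let_def)
    show "x \<rightarrow>\<^bsub>A\<^esub> y \<in> carrier A" if "x \<in> carrier A" "y \<in> carrier A" for x y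
      using cl that by (simp add: zroupoid_def)
    show "(x \<rightarrow>\<^bsub>A\<^esub> y) \<rightarrow>\<^bsub>A\<^esub> z = (((z \<rightarrow>\<^bsub>A\<^esub> \<zero>\<^bsub>A\<^esub>) \<rightarrow>\<^bsub>A\<^esub> x) \<rightarrow>\<^bsub>A\<^esub> ((y \<rightarrow>\<^bsub>A\<^esub> z) \<rightarrow>\<^bsub>A\<^esub> \<zero>\<^bsub>A\<^esub>)) \<rightarrow>\<^bsub>A\<^esub> \<zero>\<^bsub>A\<^esub>"
      if "x \<in> carrier A" "y \<in> carrier A" "z \<in> carrier A" for x y z
      using e [of "(Imp (Imp (Var 0) (Var 1)) (Var 2),
          Neg (Imp (Imp (Neg (Var 2)) (Var 0)) (Neg (Imp (Var 1) (Var 2)))))"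
          "\<lambda>n. if n = 0 then x else if n = 1 then y else z"] that
      by (auto simp: I_identities_def Let_def)
  qed
next
  assume "implication_zroupoid A"
  then interpret implication_zroupoid A .
  have "satisfies A i" if "i \<in> I_identities" for i
    using that
    by (auto simp: I_identities_def Let_def satisfies_def zero_zero_zero image_subset_iff
        intro!: imp_imp)
  then show "A \<in> I_zroupoids"
    by (simp add: I_zroupoids_def models_def zroupoid_def)
qed

lemma I_2_0_iff: "A \<in> I_2_0 \<longleftrightarrow> involutive_implication_zroupoid A"
proof -
  have "satisfies A (Neg (Neg (Var 0)), Var 0) \<longleftrightarrow>
    (\<forall>x\<in>carrier A. (x \<rightarrow>\<^bsub>A\<^esub> \<zero>\<^bsub>A\<^esub>) \<rightarrow>\<^bsub>A\<^esub> \<zero>\<^bsub>A\<^esub> = x)" (is "?l \<longleftrightarrow> ?r")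
  proof
    assume ?l
    show ?r
    proof
      fix x assume "x \<in> carrier A"
      then show "(x \<rightarrow>\<^bsub>A\<^esub> \<zero>\<^bsub>A\<^esub>) \<rightarrow>\<^bsub>A\<^esub> \<zero>\<^bsub>A\<^esub> = x"
        \<comment> \<open>A constant valuation suffices, as only one variable occurs.\<close>
        using \<open>?l\<close> [unfolded satisfies_def, rule_format, of "\<lambda>_. x"] by auto
    qed
  next
    assume ?r
    then show ?l by (auto simp: satisfies_def)
  qed
  then show ?thesis
    by (auto simp: I_2_0_def I_zroupoids_iff involutive_implication_zroupoid_def
        involutive_implication_zroupoid_axioms_def)
qed

lemma variety_I_2_0: "variety I_2_0"
proof -
  have "I_2_0 = models (insert (Neg (Neg (Var 0)), Var 0) I_identities)"
    by (auto simp: I_2_0_def I_zroupoids_def models_def)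
  then show ?thesis by (auto simp: variety_def)
qed

lemma partial_order_on_sqle:
  assumes "A \<in> I_2_0"
  shows "partial_order_on (carrier A) (sqle A)"
proof -
  interpret involutive_implication_zroupoid A
    using assms by (simp add: I_2_0_iff)
  have sqle_iff: "(x, y) \<in> sqle A \<longleftrightarrow> x \<in> carrier A \<and> y \<in> carrier A \<and> x \<rightarrow>\<^bsub>A\<^esub> \<sim> y = \<sim> x" for x y
    unfolding sqle_def neg_def by simp (metis compl_compl imp_closed zero_closed)
  show ?thesis
    unfolding partial_order_on_def preorder_on_def
  proof (intro conjI)
    show "sqle A \<subseteq> carrier A \<times> carrier A"
      by (auto simp: sqle_iff)
    show "refl_on (carrier A) (sqle A)"
      by (simp add: refl_on_def sqle_iff)
    show "trans (sqle A)"
      by (rule transI) (auto simp: sqle_iff intro: sqle_trans)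
    show "antisym (sqle A)"
      by (rule antisymI) (auto simp: sqle_iff intro: sqle_antisym)
  qed
qed

text \<open>Reflexivity exhibits every \<open>x\<close> as \<open>\<sim> \<sim> u\<close>, and \<open>\<sim> \<sim>\<close> is idempotent.\<close>

lemma refl_on_sqle_imp_I_2_0:
  assumes "A \<in> I_zroupoids" and refl: "refl_on (carrier A) (sqle A)"
  shows "A \<in> I_2_0"
proof -
  interpret implication_zroupoid A
    using assms by (simp add: I_zroupoids_iff)
  have ex: "\<exists>u\<in>carrier A. x = \<sim> u" if x: "x \<in> carrier A" for x
    using refl x by (intro bexI [of _ "x \<rightarrow>\<^bsub>A\<^esub> \<sim> x"]) (auto simp: refl_on_def sqle_def neg_def)
  have "\<sim> \<sim> x = x" if x: "x \<in> carrier A" for x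
  proof -
    obtain u where "u \<in> carrier A" "x = \<sim> \<sim> u"
      using ex x by metis
    then show ?thesis by (simp add: compl_compl_compl_compl)
  qed
  then show ?thesis
    unfolding I_2_0_iff by unfold_locales
qed

theorem theorem3p9:
  shows "(\<forall>A \<in> (I_2_0 :: 'a zroupoid set). partial_order_on (carrier A) (sqle A))
    \<and> (\<forall>V :: 'a zroupoid set.
          subvariety V I_zroupoids \<and> (\<forall>A\<in>V. partial_order_on (carrier A) (sqle A))
          \<longrightarrow> V \<subseteq> I_2_0)
    \<and> maximal_subvariety (\<lambda>A. partial_order_on (carrier A) (sqle A))
        (I_2_0 :: 'a zroupoid set) I_zroupoids"
proof -
  have *: "V \<subseteq> I_2_0"
    if "subvariety V I_zroupoids" "\<forall>A\<in>V. partial_order_on (carrier A) (sqle A)"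
    for V :: "'a zroupoid set"
    using that by (auto simp: subvariety_def intro: refl_on_sqle_imp_I_2_0 partial_order_onD(1))
  have "subvariety (I_2_0 :: 'a zroupoid set) I_zroupoids"
    using variety_I_2_0 by (auto simp: subvariety_def variety_def I_zroupoids_def I_2_0_def)
  \<comment> \<open>Maximality follows from \<open>*\<close>: a competing subvariety above
    \<open>I_2_0\<close> is also contained in it.\<close>
  with * show ?thesis
    by (auto simp: maximal_subvariety_def partial_order_on_sqle)
qed

end
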